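(* Let $r\ge 1$ be an integer. For $1\le j\le r$ define \[ c_{r,j}=(-1)^{r-1}\sum_{k=j}^{r}\frac{(-2)^{k-j}}{(k-1)!}\binom{r}{k}S(k,j) \] and \[ d_{r,j}=\sum_{\substack{j_1,\ldots,j_r\ge 0\\ j+2j_1+\cdots+2j_r=r}}\ \prod_{t=1}^{r}\frac{B_{2j_t}}{(2j_t)!}. \] Then for every $j$ with $1\le j\le r$ and $j\equiv r \pmod 2$, \[ c_{r,j}=\frac{(-1)^{r+1}2^{r-j}}{(j-1)!}\,d_{r,j}. \]
   Context: $S(k,j)$ is the unsigned Stirling number of the first kind (the number of permutations of $k$ objects with exactly $j$ cycles). $B_m$ denotes the $m$-th ordinary Bernoulli number (so $B_0=1$, $B_2=1/6$, \dots). The numbers $c_{r,j}$ are the coefficients in the identity of functions $i^r\cot^r=\frac{(-1)^r+1}{2}+\sum_{j=1}^r c_{r,j}\,i^j\cot_{j-1}$, where $\cot_l$ is the $l$-th derivative of $\cot$. *)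

theory Defs
  imports
    "HOL-Combinatorics.Stirling"
    "HOL-Computational_Algebra.Formal_Power_Series"
    "HOL-Library.FuncSet"
begin

text \<open>
  Bernoulli numbers via the exponential generating function
  \<open>x / (e^x - 1) = (\<Sum>m. B_m x^m / m!)\<close>, i.e. with the convention \<open>B_1 = -1/2\<close>.
  The quotient of formal power series cancels the common factor \<open>x\<close>.
\<close>

definition bernoulli :: "nat \<Rightarrow> real" where
  "bernoulli m = fact m * fps_nth (fps_X / (fps_exp 1 - 1)) m"

lemma bernoulli_fps: "Abs_fps (\<lambda>m. bernoulli m / fact m) * (fps_exp 1 - 1) = fps_X"
proof -
  have ne: "fps_exp 1 - 1 \<noteq> (0 :: real fps)"
  proof
    assume "fps_exp 1 - 1 = (0 :: real fps)"
    then have "fps_nth (fps_exp 1 - 1 :: real fps) 1 = 0" by simp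
    then show False by simp
  qed
  have "subdegree (fps_exp 1 - 1 :: real fps) = 1"
    by (rule subdegreeI) auto
  then have "fps_exp 1 - 1 dvd (fps_X :: real fps)"
    by (simp add: fps_dvd_iff ne)
  moreover have "Abs_fps (\<lambda>m. bernoulli m / fact m) = fps_X / (fps_exp 1 - 1)"
    by (simp add: fps_eq_iff bernoulli_def)
  ultimately show ?thesis by simp
qed

lemma bernoulli_small:
  "bernoulli 0 = 1" "bernoulli 1 = - 1 / 2" "bernoulli 2 = 1 / 6"
proof -
  have *: "(\<Sum>i=0..n. bernoulli i / fact i * (if n = i then 0 else 1 / fact (n - i))) =
      (if n = 1 then 1 else 0)" for n
  proof -
    have "fps_nth (Abs_fps (\<lambda>m. bernoulli m / fact m) * (fps_exp 1 - 1)) n = fps_nth fps_X n"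
      by (simp only: bernoulli_fps)
    moreover have "fps_nth (fps_exp 1 - 1 :: real fps) (n - i) =
        (if n = i then 0 else 1 / fact (n - i))" if "i \<in> {0..n}" for i
      using that by auto
    ultimately show ?thesis
      by (simp add: fps_mult_nth fps_X_nth cong: sum.cong_simp)
  qed
  show b0: "bernoulli 0 = 1"
    using *[of 1] by simp
  show b1: "bernoulli 1 = - 1 / 2"
    using *[of 2] b0 by (simp add: numeral_2_eq_2)
  show "bernoulli 2 = 1 / 6"
    using *[of 3] b0 b1 by (simp add: numeral_2_eq_2 numeral_3_eq_3)
qed

text \<open>
  \<^const>\<open>stirling\<close> is the unsigned Stirling number of the first kind (the capitalised
  \<^const>\<open>Stirling\<close> is the second kind).  All truncated subtractions below are exact when
  \<open>1 \<le> j \<le> r\<close>.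
\<close>

definition c_coeff :: "nat \<Rightarrow> nat \<Rightarrow> real" where
  "c_coeff r j = (- 1) ^ (r - 1) *
     (\<Sum>k=j..r. (- 2) ^ (k - j) / fact (k - 1) * real (r choose k) * real (stirling k j))"

text \<open>
  The tuples \<open>(j_1, \<dots>, j_r)\<close> are encoded as functions on \<open>{1..r}\<close> that are
  \<^const>\<open>undefined\<close> elsewhere, so that distinct functions are distinct tuples.
\<close>

definition d_index :: "nat \<Rightarrow> nat \<Rightarrow> (nat \<Rightarrow> nat) set" where
  "d_index r j = {f \<in> {1..r} \<rightarrow>\<^sub>E UNIV. j + (\<Sum>t=1..r. 2 * f t) = r}"

lemma finite_d_index: "finite (d_index r j)"
proof (rule finite_subset)
  show "d_index r j \<subseteq> {1..r} \<rightarrow>\<^sub>E {..r}"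
  proof
    fix f assume f: "f \<in> d_index r j"
    have "f t \<le> r" if "t \<in> {1..r}" for t
    proof -
      have "2 * f t \<le> (\<Sum>t=1..r. 2 * f t)"
        using that by (intro member_le_sum) auto
      with f show ?thesis by (auto simp: d_index_def)
    qed
    with f show "f \<in> {1..r} \<rightarrow>\<^sub>E {..r}" by (auto simp: d_index_def PiE_iff)
  qed
qed (auto intro: finite_PiE)

definition d_coeff :: "nat \<Rightarrow> nat \<Rightarrow> real" where
  "d_coeff r j =
     (\<Sum>f\<in>d_index r j. \<Prod>t=1..r. bernoulli (2 * f t) / fact (2 * f t))"

end

theory Submission
  imports Defs "HOL-Computational_Algebra.Formal_Laurent_Series"
begin

unbundle fps_syntax

text \<open>
  Up to the scaling \<open>x \<mapsto> 2 x\<close>, the number \<open>d_coeff r j\<close> is the coefficient of \<open>x^(r - j)\<close> in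
  \<open>(x coth x)^r\<close>, i.e. of \<open>x^(- j)\<close> in \<open>coth^r\<close>.  Up to a constant, \<open>c_coeff r j\<close> is the
  coefficient of \<open>x^r\<close> in \<open>artanh^j\<close>, because \<open>artanh x = - ln (1 - 2 x / (1 + x)) / 2\<close> and the
  Stirling numbers are the coefficients of the powers of \<open>- ln (1 - x)\<close>.  Since \<open>artanh\<close> is the
  compositional inverse of \<open>tanh\<close>, the two are related by Lagrange inversion.  In this case
  the inversion formula is elementary: the differential equations \<open>coth' = 1 - coth^2\<close> and
  \<open>(1 - x^2) artanh' = 1\<close> yield the same three-term recursion for both families.
\<close>

section \<open>Coefficients of finite products of power series\<close>

text \<open>A multiset of size \<open>n\<close> over \<open>A\<close> is determined by its
  multiplicities, so the formula \<open>fps_prod_nth'\<close>, indexed by multisets, becomes one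
  indexed by extensional functions, the encoding of tuples in \<open>d_index\<close>.\<close>

lemma fps_nth_prod_PiE:
  fixes F :: "'a \<Rightarrow> 'b :: comm_semiring_1 fps"
  assumes "finite A"
  shows "fps_nth (\<Prod>a\<in>A. F a) n =
    (\<Sum>f | f \<in> A \<rightarrow>\<^sub>E UNIV \<and> sum f A = n. \<Prod>a\<in>A. fps_nth (F a) (f a))"
proof -
  have count: "count (\<Sum>a\<in>A. replicate_mset (f a) a) x = (if x \<in> A then f x else 0)" for f x
    using assms by (simp add: count_sum)
  have "(\<Sum>X\<in>multisets_of_size A n. \<Prod>a\<in>A. fps_nth (F a) (count X a)) =
      (\<Sum>f | f \<in> A \<rightarrow>\<^sub>E UNIV \<and> sum f A = n. \<Prod>a\<in>A. fps_nth (F a) (f a))"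
  proof (rule sum.reindex_bij_witness[where
        i = "\<lambda>f. \<Sum>a\<in>A. replicate_mset (f a) a" and j = "\<lambda>X. restrict (count X) A"])
    fix X assume X: "X \<in> multisets_of_size A n"
    then have sub: "set_mset X \<subseteq> A" and size: "size X = n"
      by (auto simp: multisets_of_size_def)
    show "(\<Sum>a\<in>A. replicate_mset (restrict (count X) A a) a) = X"
      using sub by (intro multiset_eqI) (auto simp: count count_eq_zero_iff)
    have "size X = sum (count X) A"
      unfolding size_multiset_overloaded_eq using sub assms
      by (intro sum.mono_neutral_left) (auto simp: count_eq_zero_iff)
    then show "restrict (count X) A \<in> {f \<in> A \<rightarrow>\<^sub>E UNIV. sum f A = n}"
      using size by simp
  next
    fix f assume f: "f \<in> {f \<in> A \<rightarrow>\<^sub>E UNIV. sum f A = n}"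
    then show "restrict (count (\<Sum>a\<in>A. replicate_mset (f a) a)) A = f"
      by (auto simp: count fun_eq_iff PiE_def extensional_def)
    show "(\<Sum>a\<in>A. replicate_mset (f a) a) \<in> multisets_of_size A n"
      using f assms by (auto simp: multisets_of_size_def set_mset_sum split: if_splits)
  qed simp
  then show ?thesis
    using fps_prod_nth'[OF assms, of F n] by (simp only:)
qed

section \<open>Powers of x coth x\<close>

text \<open>This is \<open>(x / 2) coth (x / 2)\<close>.\<close>

definition coth_fps :: "real fps" where
  "coth_fps = Abs_fps (\<lambda>m. bernoulli (2 * m) / fact (2 * m)) oo fps_X ^ 2"

lemma coth_fps_nth: "coth_fps $ n = (if even n then bernoulli n / fact n else 0)"
  by (simp add: coth_fps_def fps_nth_compose_X_power)

text \<open>With G(x) = x / (e^x - 1), \<open>coth_fps\<close> is the even part (G(x) + G(-x)) / 2,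
  and G(-x) = x e^x / (e^x - 1) = G(x) + x. In particular -x/2 is the only odd term of G.\<close>

lemma coth_fps_eq_bernoulli_fps:
  "coth_fps = Abs_fps (\<lambda>m. bernoulli m / fact m) + fps_const (1 / 2) * fps_X"
proof -
  define G where "G = Abs_fps (\<lambda>m. bernoulli m / fact m)"
  define G' where "G' = G oo - fps_X"
  define e where "e = (fps_exp 1 :: real fps)"
  define e' where "e' = (fps_exp (-1) :: real fps)"
  have e: "e * e' = 1"
    unfolding e_def e'_def by (simp flip: fps_exp_add_mult)
  have 1: "G * (e - 1) = fps_X"
    using bernoulli_fps by (simp add: G_def e_def)
  have "(G * (e - 1)) oo - fps_X = - fps_X"
    by (simp add: 1)
  moreover have "e oo - fps_X = e'"
    unfolding e_def e'_def by (simp add: fps_compose_uminus' fps_eq_iff)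
  ultimately have 2: "G' * (e' - 1) = - fps_X"
    by (simp add: fps_compose_mult_distrib fps_compose_sub_distrib G'_def)
  have "(G' - (G + fps_X)) * (e - 1) = 0"
  proof -
    \<comment> \<open>Multiplying by \<open>e\<close> clears \<open>e'\<close>, so that
      \<open>G'\<close> and \<open>G\<close> get the same denominator up to sign.\<close>
    have "G' * (1 - e) = - fps_X * e"
      using arg_cong[OF 2, of "\<lambda>t. t * e"] e by (simp add: algebra_simps)
    then show ?thesis
      using 1 by (simp add: algebra_simps)
  qed
  moreover have "e - 1 \<noteq> 0"
    using 1 by auto
  ultimately have "G' = G + fps_X"
    by simp
  moreover have "2 * coth_fps = G + G'"
    by (simp add: fps_eq_iff coth_fps_nth G_def G'_def fps_compose_uminus' 
        fps_numeral_fps_const)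
  ultimately have "fps_const (1/2) * (2 * coth_fps) = fps_const (1/2) * (2 * G + fps_X)"
    by simp
  moreover have "fps_const (1/2) * (2 * f) = f" for f :: "real fps"
    by (simp add: numeral_fps_const flip: mult.assoc)
  ultimately show ?thesis
    by (simp add: ring_distribs G_def)
qed

text \<open>This is coth' = 1 - coth^2 in terms of (x/2) coth(x/2). Differentiating
  \<open>G * (e - 1) = fps_X\<close> gives a Riccati equation for \<open>G\<close>; the shift by x/2
  completes the square and absorbs its term \<open>G * fps_X\<close>.\<close>

lemma coth_fps_ODE:
  "fps_X * fps_deriv coth_fps = coth_fps + fps_const (1 / 4) * fps_X\<^sup>2 - coth_fps\<^sup>2"
proof -
  define G where "G = Abs_fps (\<lambda>m. bernoulli m / fact m)"
  define e where "e = (fps_exp 1 :: real fps)"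
  define h where "h = (fps_const (1/2) :: real fps)"
  have h: "2 * h = 1" "fps_const (1/4) = h * h"
    by (simp_all add: h_def numeral_fps_const)
  have 1: "G * (e - 1) = fps_X"
    using bernoulli_fps by (simp add: G_def e_def)
  have "fps_deriv (G * (e - 1)) = 1"
    by (simp add: 1)
  then have 2: "fps_deriv G * (e - 1) + G * e = 1"
    by (simp add: e_def algebra_simps)
  \<comment> \<open>Writing \<open>fps_X\<close> as \<open>G * (e - 1)\<close> brings in the product
    \<open>fps_deriv G * (e - 1)\<close>, which fact \<open>2\<close> eliminates.\<close>
  have "fps_X * fps_deriv G = G * (fps_deriv G * (e - 1))"
    unfolding 1[symmetric] by (simp only: ac_simps)
  also have "\<dots> = G - G * (G * (e - 1)) - G\<^sup>2"
    using 2 by algebra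
  finally have 3: "fps_X * fps_deriv G = G - G * fps_X - G\<^sup>2"
    by (simp add: 1)
  have E: "coth_fps = G + h * fps_X"
    by (simp add: coth_fps_eq_bernoulli_fps G_def h_def)
  have E': "fps_deriv coth_fps = fps_deriv G + h"
    by (simp add: E h_def)
  show ?thesis
    unfolding E' unfolding E h(2) using 3 h(1) by algebra
qed

text \<open>The differential equation times r f^(r-1), with f = \<open>coth_fps\<close>, is compared
  at x^(r-j). The operator x d/dx contributes the weight r - j, and r - (r - j) = j.\<close>

lemma coth_fps_power_recurrence:
  assumes "r \<ge> 1" "j \<le> r"
  shows "real r * (coth_fps ^ Suc r) $ (r - j) = real j * (coth_fps ^ r) $ (r - j) +
    real r / 4 * (if r - j < 2 then 0 else (coth_fps ^ (r - 1)) $ (r - j - 2))"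
proof -
  have pow: "coth_fps * coth_fps ^ (r - 1) = coth_fps ^ r"
    using assms by (metis power_minus_mult mult.commute less_le_trans zero_less_one)
  have "fps_X * fps_deriv (coth_fps ^ r) =
      of_nat r * (fps_X * fps_deriv coth_fps) * coth_fps ^ (r - 1)"
    by (simp add: fps_deriv_power fps_of_nat algebra_simps)
  also have "\<dots> = of_nat r * (coth_fps * coth_fps ^ (r - 1) +
      fps_const (1 / 4) * fps_X\<^sup>2 * coth_fps ^ (r - 1) - coth_fps * (coth_fps * coth_fps ^ (r - 1)))"
    unfolding coth_fps_ODE by (simp add: algebra_simps power2_eq_square)
  finally have *: "fps_X * fps_deriv (coth_fps ^ r) = fps_const (real r) * (coth_fps ^ r +
      fps_const (1 / 4) * (fps_X\<^sup>2 * coth_fps ^ (r - 1)) - coth_fps ^ Suc r)"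
    by (simp only: pow power_Suc fps_of_nat mult.assoc)
  have "real (r - j) * (coth_fps ^ r) $ (r - j) = real r * ((coth_fps ^ r) $ (r - j) +
      1 / 4 * (if r - j < 2 then 0 else (coth_fps ^ (r - 1)) $ (r - j - 2)) -
      (coth_fps ^ Suc r) $ (r - j))"
    using arg_cong[OF *, of "\<lambda>f. f $ (r - j)"]
    by (simp only: fps_mult_left_const_nth fps_sub_nth fps_add_nth fps_X_power_mult_nth
        fps_mult_fps_X_deriv_shift fps_nth_Abs_fps)
  then show ?thesis
    using assms by (simp add: of_nat_diff algebra_simps)
qed

text \<open>\<open>coth_fps\<close> is a series \<open>F\<close> in x^2, so the coefficient is that
  of x^((r-j)/2) in \<open>F ^ r\<close>; the parity condition makes the halving exact.\<close>

lemma d_coeff_eq_fps_nth: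
  assumes "j \<le> r" "j mod 2 = r mod 2"
  shows "d_coeff r j = (coth_fps ^ r) $ (r - j)"
proof -
  define F where "F = Abs_fps (\<lambda>m. bernoulli (2 * m) / fact (2 * m))"
  have ev: "2 dvd r - j"
    using assms by presburger
  have "(coth_fps ^ r) $ (r - j) = (F ^ r oo fps_X ^ 2) $ (r - j)"
    by (simp add: coth_fps_def F_def fps_compose_power)
  also have "\<dots> = (F ^ r) $ ((r - j) div 2)"
    using ev by (simp only: fps_nth_compose_X_power if_True)
  also have "F ^ r = (\<Prod>t\<in>{1..r}. F)"
    by simp
  also have "\<dots> $ ((r - j) div 2) = (\<Sum>f | f \<in> {1..r} \<rightarrow>\<^sub>E UNIV \<and> sum f {1..r} = (r - j) div 2.
      \<Prod>t\<in>{1..r}. F $ f t)"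
    by (rule fps_nth_prod_PiE) simp
  also have "{f. f \<in> {1..r} \<rightarrow>\<^sub>E UNIV \<and> sum f {1..r} = (r - j) div 2} = d_index r j"
    using ev assms(1) by (auto simp: d_index_def simp flip: sum_distrib_left)
  finally show ?thesis
    by (simp add: d_coeff_def F_def)
qed

section \<open>Powers of the logarithm and of artanh\<close>

text \<open>This is \<open>(- ln (1 - x))^j / j!\<close>.\<close>

definition stirling_fps :: "nat \<Rightarrow> real fps" where
  "stirling_fps j = Abs_fps (\<lambda>k. real (stirling k j) / fact k)"

lemma stirling_fps_0: "stirling_fps 0 = 1"
proof (rule fps_ext)
  show "stirling_fps 0 $ n = 1 $ n" for n
    by (cases n) (simp_all add: stirling_fps_def)
qed

text \<open>Coefficientwise this is S(n+1, j+1) = n S(n, j+1) + S(n, j), divided by n!.\<close>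

lemma stirling_fps_ODE: "(1 - fps_X) * fps_deriv (stirling_fps (Suc j)) = stirling_fps j"
proof (rule fps_ext)
  fix n
  have deriv: "fps_deriv (stirling_fps (Suc j)) $ m = real (stirling (Suc m) (Suc j)) / fact m" for m
    by (simp add: stirling_fps_def field_simps del: stirling.simps of_nat_Suc)
  show "((1 - fps_X) * fps_deriv (stirling_fps (Suc j))) $ n = stirling_fps j $ n"
  proof (cases n)
    case (Suc m)
    have "real (stirling (Suc n) (Suc j)) / fact n =
        real (stirling n (Suc j)) / fact m + real (stirling n j) / fact n"
      by (simp add: Suc field_simps del: of_nat_Suc) (simp add: algebra_simps)
    then show ?thesis
      by (simp add: left_diff_distrib deriv Suc del: fps_deriv_nth stirling.simps)
        (simp add: stirling_fps_def)
  qed (simp add: stirling_fps_def)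
qed

text \<open>This is \<open>(2 artanh x)^j / j!\<close>.\<close>

definition artanh_fps :: "nat \<Rightarrow> real fps" where
  "artanh_fps j = stirling_fps j oo (2 * fps_X * inverse (1 + fps_X))"

lemma artanh_fps_0: "artanh_fps 0 = 1"
  by (simp add: artanh_fps_def stirling_fps_0)

lemma artanh_fps_nth_0: "artanh_fps (Suc j) $ 0 = 0"
  by (simp add: artanh_fps_def stirling_fps_def)

text \<open>By the chain rule with u = 2x / (1+x): 1 - u = (1-x) / (1+x) and u' = 2 / (1+x)^2, hence
  u' / (1-u) = 2 / (1-x^2).\<close>

lemma artanh_fps_ODE: "(1 - fps_X\<^sup>2) * fps_deriv (artanh_fps (Suc j)) = 2 * artanh_fps j"
proof -
  define I where "I = (inverse (1 + fps_X) :: real fps)"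
  define u where "u = 2 * fps_X * I"
  define s where "s = fps_deriv (stirling_fps (Suc j)) oo u"
  have I: "I * (1 + fps_X) = 1"
    unfolding I_def by (rule inverse_mult_eq_1) simp
  have u0: "u $ 0 = 0"
    by (simp add: u_def)
  have u: "u = 2 - 2 * I"
    using I unfolding u_def by algebra
  have "fps_deriv I = - I\<^sup>2"
    unfolding I_def by (subst fps_inverse_deriv) simp_all
  then have u': "fps_deriv u = 2 * I\<^sup>2"
    by (simp add: u)
  have "((1 - fps_X) * fps_deriv (stirling_fps (Suc j))) oo u = artanh_fps j"
    by (simp add: stirling_fps_ODE artanh_fps_def u_def I_def)
  then have 1: "(1 - u) * s = artanh_fps j"
    using u0 by (simp add: fps_compose_mult_distrib fps_compose_sub_distrib s_def)
  have 2: "fps_deriv (artanh_fps (Suc j)) = s * fps_deriv u"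
    using fps_compose_deriv[OF u0] by (simp add: artanh_fps_def u_def I_def s_def)
  show ?thesis
    unfolding 2 u' 1[symmetric] unfolding u using I by algebra
qed

lemma artanh_fps_nth_1: "artanh_fps (Suc j) $ 1 = 2 * artanh_fps j $ 0"
  using arg_cong[OF artanh_fps_ODE, of "\<lambda>f. f $ 0"] by simp

lemma artanh_fps_recurrence:
  assumes "n \<ge> 1"
  shows "real (Suc n) * artanh_fps (Suc j) $ Suc n =
    real (n - 1) * artanh_fps (Suc j) $ (n - 1) + 2 * artanh_fps j $ n"
proof -
  have "fps_deriv (artanh_fps (Suc j)) - fps_X * (fps_X * fps_deriv (artanh_fps (Suc j))) =
      fps_const 2 * artanh_fps j"
    using artanh_fps_ODE[of j] by (simp add: algebra_simps power2_eq_square numeral_fps_const)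
  from arg_cong[OF this, of "\<lambda>f. f $ n"] show ?thesis
    using assms by (cases n) (simp_all add: fps_mult_fps_X_deriv_shift)
qed

text \<open>The powers of 2x / (1+x) are expanded by the binomial series with exponent -k.\<close>

lemma artanh_fps_nth:
  assumes "1 \<le> j" "j \<le> r"
  shows "artanh_fps j $ r = (\<Sum>k=j..r. real (stirling k j) / fact k * 2 ^ k *
    (- 1) ^ (r - k) * real ((r - 1) choose (k - 1)))"
proof -
  have u: "((2 * fps_X * inverse (1 + fps_X)) ^ k) $ r =
      (2::real) ^ k * (- 1) ^ (r - k) * real ((r - 1) choose (k - 1))" if "1 \<le> k" "k \<le> r" for k
  proof -
    have "(2 * fps_X * inverse (1 + fps_X :: real fps)) ^ k =
        fps_const (2 ^ k) * (fps_X ^ k * fps_binomial (- of_nat k))"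
      by (simp add: power_mult_distrib fps_binomial_minus_of_nat fps_inverse_power
          numeral_fps_const fps_const_power mult.assoc)
    then have "((2 * fps_X * inverse (1 + fps_X)) ^ k) $ r =
        (2::real) ^ k * ((- of_nat k) gchoose (r - k))"
      using that by (simp add: fps_X_power_mult_nth)
    \<comment> \<open>Upper negation; the new upper index is k + (r - k) - 1 = r - 1.\<close>
    also have "(- of_nat k :: real) gchoose (r - k) =
        (- 1) ^ (r - k) * (of_nat (r - 1) gchoose (r - k))"
      using that by (subst gbinomial_minus) (simp add: of_nat_diff)
    also have "(of_nat (r - 1) :: real) gchoose (r - k) = real ((r - 1) choose (r - k))"
      by (simp add: binomial_gbinomial)
    also have "(r - 1) choose (r - k) = (r - 1) choose (k - 1)"
      using that by (subst binomial_symmetric) auto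
    finally show ?thesis
      by simp
  qed
  have "artanh_fps j $ r =
      (\<Sum>k=0..r. real (stirling k j) / fact k * ((2 * fps_X * inverse (1 + fps_X)) ^ k) $ r)"
    by (simp add: artanh_fps_def fps_compose_nth stirling_fps_def)
  also have "\<dots> =
      (\<Sum>k=j..r. real (stirling k j) / fact k * ((2 * fps_X * inverse (1 + fps_X)) ^ k) $ r)"
    using assms by (intro sum.mono_neutral_right) auto
  also have "\<dots> = (\<Sum>k=j..r. real (stirling k j) / fact k * 2 ^ k *
      (- 1) ^ (r - k) * real ((r - 1) choose (k - 1)))"
    using assms by (intro sum.cong refl) (simp add: u)
  finally show ?thesis .
qed

section \<open>Lagrange inversion for tanh and artanh\<close>

text \<open>Both sides satisfy r y(r+1, i+1) = 2 i y(r, i) + r y(r-1, i+1), which determines row r+1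
  for r >= 1 from the two rows before it. The left side is 0 for j > r so that the recursion also
  holds at the boundary.\<close>

lemma coth_fps_artanh_fps_Lagrange:
  assumes "j \<ge> 1"
  shows "(if j \<le> r then 2 ^ r * (coth_fps ^ r) $ (r - j) else 0) =
    real r * fact (j - 1) * artanh_fps j $ r"
  using assms
proof (induction r arbitrary: j rule: less_induct)
  case (less n)
  define a where "a = (\<lambda>r j. if j \<le> r then 2 ^ r * (coth_fps ^ r) $ (r - j) else 0)"
  define b where "b = (\<lambda>r j. real r * fact (j - 1) * artanh_fps j $ r)"
  have IH: "a m i = b m i" if "m < n" "i \<ge> 1" for m i
    using less.IH[of m i] that by (simp add: a_def b_def)
  obtain i where j: "j = Suc i"
    using less.prems by (cases j) auto
  consider "n = 0" | "n = 1" | r where "n = Suc r" "r \<ge> 1"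
    by (cases n) force+
  then have "a n j = b n j"
  proof cases
    case 1
    then show ?thesis
      using less.prems by (simp add: a_def b_def)
  next
    case 2
    \<comment> \<open>In row 1 both sides are 2 for j = 1 and 0 for larger j.\<close>
    then show ?thesis
      using artanh_fps_nth_1[of i]
      by (cases i) (simp_all add: a_def b_def j artanh_fps_nth_0 artanh_fps_0
          coth_fps_nth bernoulli_small)
  next
    case (3 r)
    have b: "real r * b (Suc r) (Suc i) = 2 * real i * b r i + real r * b (r - 1) (Suc i)"
    proof -
      have "b (Suc r) (Suc i) = fact i * (real (Suc r) * artanh_fps (Suc i) $ Suc r)"
        by (simp add: b_def)
      also have "\<dots> = b (r - 1) (Suc i) + 2 * fact i * artanh_fps i $ r"
        unfolding artanh_fps_recurrence[OF \<open>r \<ge> 1\<close>] by (simp add: b_def algebra_simps)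
      finally have "b (Suc r) (Suc i) = b (r - 1) (Suc i) + 2 * fact i * artanh_fps i $ r" .
      \<comment> \<open>The factor \<open>real i\<close> turns \<open>fact (i - 1)\<close> into
        \<open>fact i\<close>; at i = 0 both sides vanish because \<open>artanh_fps 0 = 1\<close>
        and r >= 1.\<close>
      moreover have "real i * b r i = real r * fact i * artanh_fps i $ r"
        using \<open>r \<ge> 1\<close> by (cases i) (simp_all add: b_def artanh_fps_0)
      ultimately show ?thesis
        by (simp add: distrib_left)
    qed
    have a: "real r * a (Suc r) (Suc i) = 2 * real i * a r i + real r * a (r - 1) (Suc i)"
    proof (cases "i \<le> r")
      case True
      define q where "q = (if r - i < 2 then 0 else (coth_fps ^ (r - 1)) $ (r - i - 2))"
      have "a (r - 1) (Suc i) = 2 ^ (r - 1) * q"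
        using True \<open>r \<ge> 1\<close> by (auto simp: a_def q_def numeral_2_eq_2)
      moreover have "a r i = 2 * 2 ^ (r - 1) * (coth_fps ^ r) $ (r - i)"
        using True \<open>r \<ge> 1\<close> by (cases r) (simp_all add: a_def)
      moreover have "real r * a (Suc r) (Suc i) =
          4 * 2 ^ (r - 1) * (real r * (coth_fps ^ Suc r) $ (r - i))"
        using True \<open>r \<ge> 1\<close> by (cases r) (simp_all add: a_def)
      moreover have "real r * (coth_fps ^ Suc r) $ (r - i) =
          real i * (coth_fps ^ r) $ (r - i) + real r / 4 * q"
        unfolding q_def by (rule coth_fps_power_recurrence) fact+
      ultimately show ?thesis
        by (simp only:) (simp add: algebra_simps)
    next
      case False
      then show ?thesis
        by (simp add: a_def)
    qed
    \<comment> \<open>The induction hypothesis covers only i >= 1; at i = 0 the factor is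
      zero.\<close>
    have "real i * a r i = real i * b r i"
      using IH[of r i] \<open>n = Suc r\<close> by (cases "i = 0") auto
    moreover have "a (r - 1) (Suc i) = b (r - 1) (Suc i)"
      using \<open>n = Suc r\<close> \<open>r \<ge> 1\<close> by (intro IH) auto
    ultimately have "real r * a n j = real r * b n j"
      using a b by (simp add: j \<open>n = Suc r\<close>)
    then show ?thesis
      using \<open>r \<ge> 1\<close> by simp
  qed
  then show ?case
    by (simp add: a_def b_def)
qed

section \<open>Termwise comparison of \<open>c_coeff\<close> with the artanh coefficients\<close>

theorem theorem2:
  fixes r j :: nat
  assumes "r \<ge> 1" and "1 \<le> j" and "j \<le> r" and "j mod 2 = r mod 2"
  shows "c_coeff r j = (- 1) ^ (r + 1) * 2 ^ (r - j) / fact (j - 1) * d_coeff r j"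
proof -
  have d: "2 ^ r * d_coeff r j = real r * fact (j - 1) * artanh_fps j $ r"
    using coth_fps_artanh_fps_Lagrange[OF \<open>1 \<le> j\<close>, of r] d_coeff_eq_fps_nth assms by simp
  \<comment> \<open>The factor \<open>2 ^ j\<close> turns 2^(k-j) into the 2^k of the artanh
    expansion, so the two sums agree term by term.\<close>
  have "2 ^ j * c_coeff r j = (- 1) ^ (r + 1) * (real r * artanh_fps j $ r)"
    unfolding c_coeff_def artanh_fps_nth[OF assms(2,3)] sum_distrib_left
  proof (intro sum.cong refl)
    fix k assume "k \<in> {j..r}"
    then have k: "j \<le> k" "k \<le> r" "1 \<le> k"
      using assms by auto
    have pow: "(2::real) ^ k = 2 ^ j * 2 ^ (k - j)"
      using k by (simp flip: power_add)
    \<comment> \<open>The parity assumption reconciles the sign (-1)^(k-j) in \<open>c_coeff\<close>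
      with (-1)^(r-k).\<close>
    have "even (r - j)"
      using assms by presburger
    then have "even (k - j) \<longleftrightarrow> even (r - k)"
      using k by auto
    then have sign: "(- 1 :: real) ^ (r - k) = (- 1) ^ (k - j)"
      by (auto simp: minus_one_power_iff)
    have neg: "(- 2 :: real) ^ (k - j) = (- 1) ^ (k - j) * 2 ^ (k - j)"
      by (simp flip: power_mult_distrib)
    have r: "(- 1 :: real) ^ (r - 1) = (- 1) ^ (r + 1)"
      using assms by (cases r) auto
    \<comment> \<open>Absorption trades \<open>r choose k\<close> over (k-1)! for
      \<open>(r - 1) choose (k - 1)\<close> over k!, at the cost of a factor r.\<close>
    have "k * (r choose k) = r * ((r - 1) choose (k - 1))"
      using k by (simp add: times_binomial_minus1_eq)
    then have "real k * real (r choose k) = real r * real ((r - 1) choose (k - 1))"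
      by (metis of_nat_mult)
    moreover have "(fact k :: real) = real k * fact (k - 1)"
      using k by (simp add: fact_reduce)
    ultimately have choose: "real (r choose k) / fact (k - 1) =
        real r * real ((r - 1) choose (k - 1)) / fact k"
      using k by (simp add: field_simps)
    have "2 ^ j * ((- 1) ^ (r - 1) * ((- 2) ^ (k - j) / fact (k - 1) * real (r choose k) *
        real (stirling k j))) =
      2 ^ j * ((- 1) ^ (r - 1) * ((- 2) ^ (k - j) * real (stirling k j) *
        (real (r choose k) / fact (k - 1))))"
      by simp
    also have "\<dots> = (- 1) ^ (r + 1) * (real r * (real (stirling k j) / fact k * 2 ^ k *
        (- 1) ^ (r - k) * real ((r - 1) choose (k - 1))))"
      unfolding choose r neg sign pow by simp
    finally show "2 ^ j * ((- 1) ^ (r - 1) * ((- 2) ^ (k - j) / fact (k - 1) *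
        real (r choose k) * real (stirling k j))) = \<dots>" .
  qed
  also have "\<dots> = (- 1) ^ (r + 1) * (2 ^ r * d_coeff r j / fact (j - 1))"
    by (simp add: d)
  also have "(2::real) ^ r = 2 ^ j * 2 ^ (r - j)"
    using assms by (simp flip: power_add)
  finally have "2 ^ j * c_coeff r j =
      2 ^ j * ((- 1) ^ (r + 1) * 2 ^ (r - j) / fact (j - 1) * d_coeff r j)"
    by (simp only: times_divide_eq_left times_divide_eq_right ac_simps)
  then show ?thesis
    by (simp only: mult_cancel_left) simp
qed

end
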